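(* Let $A\in\mathbb{R}^{n\times n}$, $B\in\mathbb{R}^{n\times m}$, $C\in\mathbb{R}^{m\times n}$, $D\in\mathbb{R}^{m\times m}$ be such that the state-space system $\dot x(t)=Ax(t)+Bu(t)$, $y(t)=Cx(t)+Du(t)$ is minimal, and let $$P=\begin{bmatrix} A & B\\ C & D\end{bmatrix}\in\mathbb{R}^{(n+m)\times(n+m)}$$ be its system matrix. The system represented by $P$ is symmetrizable if and only if there exists a non-singular matrix $Q\in\mathbb{R}^{(n+m)\times(n+m)}$ such that $$PQ=QP^\top,\qquad Q=Q^\top,\qquad Q_{12}=0,$$ where $Q_{12}=[I_n\;\,0]\,Q\,[0\;\,I_m]^\top\in\mathbb{R}^{n\times m}$ is the upper-right off-diagonal block of $Q$.
   Context: The transfer function of the state-space system is $G(s)=C(sI-A)^{-1}B+D$, an $m\times m$ matrix of real rational functions. The system is minimal if $(A,B)$ is controllable and $(A,C)$ is observable. A signature matrix is a diagonal matrix whose diagonal elements are each $+1$ or $-1$. A linear system with $m\times m$ transfer function $H(s)$ is symmetric if there is a signature matrix $\Sigma_e\in\mathbb{R}^{m\times m}$ such that $\Sigma_e H^\top(s)=H(s)\Sigma_e$. A linear system with $m\times m$ transfer function $G(s)$ is symmetrizable if there exists a constant invertible matrix $K\in\mathbb{R}^{m\times m}$ such that the transformed system $H(s)=K^{-1}G(s)K$ is symmetric. *)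

theory Defs
  imports
    "HOL-Analysis.Analysis"
    "HOL-Computational_Algebra.Polynomial_Factorial"
begin

(* The dimensions n and m are the cardinalities of the index types 'n and 'm;
   block matrices of size n + m are indexed by the sum type 'n + 'm. *)

(* x is a solution of x' = A x + B u on [0, T]. Taking the inputs to be continuous rather than,
   say, piecewise continuous does not affect which pairs are controllable. *)
definition state_trajectory ::
  "real^'n^'n \<Rightarrow> real^'m^'n \<Rightarrow> real \<Rightarrow> (real \<Rightarrow> real^'m) \<Rightarrow> (real \<Rightarrow> real^'n) \<Rightarrow> bool" where
  "state_trajectory A B T u x \<longleftrightarrow>
     continuous_on {0..T} u \<and>
     (\<forall>t\<in>{0..T}. (x has_vector_derivative (A *v x t + B *v u t)) (at t within {0..T}))"

definition controllable :: "real^'n^'n \<Rightarrow> real^'m^'n \<Rightarrow> bool" where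
  "controllable A B \<longleftrightarrow>
     (\<forall>x0 x1. \<exists>T>0. \<exists>u x. state_trajectory A B T u x \<and> x 0 = x0 \<and> x T = x1)"

(* The initial state is determined by the output over a finite interval. A known input only adds
   a known signal to the output, so the unforced system x' = A x, y = C x is considered. *)
definition observable :: "real^'n^'n \<Rightarrow> real^'n^'m \<Rightarrow> bool" where
  "observable A C \<longleftrightarrow>
     (\<forall>x0. \<exists>T>0. \<forall>x z.
        (\<forall>t\<in>{0..T}. (x has_vector_derivative (A *v x t)) (at t within {0..T})) \<longrightarrow>
        (\<forall>t\<in>{0..T}. (z has_vector_derivative (A *v z t)) (at t within {0..T})) \<longrightarrow>
        x 0 = x0 \<longrightarrow>
        (\<forall>t\<in>{0..T}. C *v x t = C *v z t) \<longrightarrow> z 0 = x0)"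

definition minimal_system :: "real^'n^'n \<Rightarrow> real^'m^'n \<Rightarrow> real^'n^'m \<Rightarrow> bool" where
  "minimal_system A B C \<longleftrightarrow> controllable A B \<and> observable A C"

(* Real rational functions form the fraction field of the polynomial ring. *)
type_synonym ratfun = "real poly fract"

definition const_ratfun :: "real \<Rightarrow> ratfun" where
  "const_ratfun c = to_fract [:c:]"

definition ratfun_s :: ratfun where
  "ratfun_s = to_fract [:0, 1:]"

definition const_matrix :: "real^'a^'b \<Rightarrow> ratfun^'a^'b" where
  "const_matrix M = map_matrix const_ratfun M"

(* s I - A is invertible over the field of rational functions, its determinant being the
   characteristic polynomial of A, so matrix_inv is a genuine inverse here. *)
definition transfer_function ::
  "real^'n^'n \<Rightarrow> real^'m^'n \<Rightarrow> real^'n^'m \<Rightarrow> real^'m^'m \<Rightarrow> ratfun^'m^'m" where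
  "transfer_function A B C D =
     const_matrix C ** matrix_inv (mat ratfun_s - const_matrix A) ** const_matrix B
       + const_matrix D"

definition signature_matrix :: "real^'m^'m \<Rightarrow> bool" where
  "signature_matrix S \<longleftrightarrow>
     (\<forall>i j. i \<noteq> j \<longrightarrow> S $ i $ j = 0) \<and> (\<forall>i. S $ i $ i = 1 \<or> S $ i $ i = - 1)"

definition symmetric_system :: "ratfun^'m^'m \<Rightarrow> bool" where
  "symmetric_system H \<longleftrightarrow>
     (\<exists>S. signature_matrix S \<and> const_matrix S ** transpose H = H ** const_matrix S)"

definition symmetrizable :: "ratfun^'m^'m \<Rightarrow> bool" where
  "symmetrizable G \<longleftrightarrow>
     (\<exists>K :: real^'m^'m. invertible K \<and>
        symmetric_system (const_matrix (matrix_inv K) ** G ** const_matrix K))"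

definition system_matrix ::
  "real^'n^'n \<Rightarrow> real^'m^'n \<Rightarrow> real^'n^'m \<Rightarrow> real^'m^'m \<Rightarrow> real^('n + 'm)^('n + 'm)" where
  "system_matrix A B C D =
     (\<chi> i j. case i of
        Inl a \<Rightarrow> (case j of Inl b \<Rightarrow> A $ a $ b | Inr b \<Rightarrow> B $ a $ b)
      | Inr a \<Rightarrow> (case j of Inl b \<Rightarrow> C $ a $ b | Inr b \<Rightarrow> D $ a $ b))"

definition upper_right_block :: "real^('n + 'm)^('n + 'm) \<Rightarrow> real^'m^'n" where
  "upper_right_block Q = (\<chi> a b. Q $ Inl a $ Inr b)"

end

theory Submission
  imports Defs
begin

text \<open>
  Symmetrizability of a transfer function \<open>G\<close> amounts to the existence of an invertible symmetric
  real matrix \<open>M\<close> with \<open>G M = M G\<^sup>T\<close>: if \<open>K\<close> symmetrizes \<open>G\<close> with signature \<open>S\<close>, then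
  \<open>M = K S K\<^sup>T\<close>, and Sylvester's law of inertia writes any such \<open>M\<close> in this form
  (\<open>symmetrizable_iff_symmetric_intertwiner\<close>). A symmetric \<open>Q\<close> with vanishing upper right block is
  block diagonal with symmetric blocks \<open>T\<close> and \<open>M\<close>, and \<open>P Q = Q P\<^sup>T\<close> says
  \<open>A T = T A\<^sup>T\<close>, \<open>B M = T C\<^sup>T\<close>, \<open>C T = M B\<^sup>T\<close> and \<open>D M = M D\<^sup>T\<close>.

  The relation \<open>G M = M G\<^sup>T\<close> states that the realizations \<open>(A, B M, C, D M)\<close> and
  \<open>(A\<^sup>T, C\<^sup>T, M B\<^sup>T, M D\<^sup>T)\<close> have the same transfer function, while the block equations state that
  \<open>T\<close> is a similarity from the second to the first and that the feedthrough terms agree. A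
  similarity preserves the transfer function (\<open>transfer_function_eq_if_intertwined\<close>), which gives
  one direction. For the other, equal transfer functions have equal Markov parameters
  (\<open>transfer_function_determines_markov_parameters\<close>), so minimality provides a similarity \<open>T\<close>
  (\<open>state_space_isomorphism\<close>). The transpose of \<open>T\<close> satisfies the same equations, and uniqueness of
  the similarity (\<open>state_space_isomorphism_unique\<close>) makes \<open>T\<close> symmetric.

  Minimality is given in terms of trajectories. It enters only through Kalman's algebraic
  conditions, which follow from it with the help of the trajectories \<open>exp (t A) x\<close>. Rational
  functions are compared through their growth at infinity, where strictly proper functions vanish.
\<close>

section \<open>Matrix identities\<close>

lemma matrix_add_rdistrib:
  fixes M N :: "'a::semiring_1^'n^'m"
  shows "(M + N) ** L = M ** L + N ** L"
  by (simp add: matrix_matrix_mult_def vec_eq_iff distrib_right sum.distrib)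

lemma matrix_diff_rdistrib:
  fixes M N :: "'a::ring_1^'n^'m"
  shows "(M - N) ** L = M ** L - N ** L"
  by (simp add: matrix_matrix_mult_def vec_eq_iff left_diff_distrib sum_subtractf)

lemma matrix_diff_ldistrib:
  fixes M N :: "'a::ring_1^'n^'m"
  shows "L ** (M - N) = L ** M - L ** N"
  by (simp add: matrix_matrix_mult_def vec_eq_iff right_diff_distrib sum_subtractf)

lemma matrix_mult_0 [simp]: "M ** 0 = 0" "0 ** M = 0" for M :: "'a::semiring_1^'n^'m"
  by (simp_all add: matrix_matrix_mult_def vec_eq_iff)

lemma mat_mult_entry: "((mat a :: 'a::semiring_1^'n^'n) ** M) $ i $ j = a * M $ i $ j"
proof -
  have "(\<Sum>k\<in>UNIV. (if i = k then a else 0) * M $ k $ j) = (\<Sum>k\<in>UNIV. if k = i then a * M $ k $ j else 0)"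
    by (intro sum.cong) auto
  then show ?thesis by (simp add: matrix_matrix_mult_def mat_def)
qed

lemma matrix_mult_mat_entry: "(M ** (mat a :: 'a::comm_semiring_1^'n^'n)) $ i $ j = a * M $ i $ j"
proof -
  have "(\<Sum>k\<in>UNIV. M $ i $ k * (if k = j then a else 0)) = (\<Sum>k\<in>UNIV. if k = j then a * M $ i $ j else 0)"
    by (intro sum.cong) (auto simp: mult.commute)
  then show ?thesis by (simp add: matrix_matrix_mult_def mat_def)
qed

lemma mat_commute: "(mat a :: 'a::comm_semiring_1^'n^'n) ** M = M ** mat a"
  by (simp add: vec_eq_iff mat_mult_entry matrix_mult_mat_entry)

lemma transpose_add: "transpose (M + N) = transpose M + transpose N"
  by (simp add: transpose_def vec_eq_iff)

lemma transpose_diff: "transpose (M - N) = transpose M - transpose N"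
  by (simp add: transpose_def vec_eq_iff)

lemma transpose_0 [simp]: "transpose 0 = 0"
  by (simp add: transpose_def vec_eq_iff)

lemma matrix_inverse:
  assumes "invertible M"
  shows "M ** matrix_inv M = mat 1" "matrix_inv M ** M = mat 1"
  using assms someI_ex[of "\<lambda>M'. M ** M' = mat 1 \<and> M' ** M = mat 1"]
  unfolding invertible_def matrix_inv_def by auto

lemma matrix_inv_unique:
  assumes "M ** N = mat 1" "N ** M = mat 1"
  shows "matrix_inv M = N"
proof -
  have "invertible M" using assms by (auto simp: invertible_def)
  then have "matrix_inv M = matrix_inv M ** (M ** N)" by (simp add: assms)
  also have "\<dots> = N"
    using \<open>invertible M\<close> by (simp add: matrix_mul_assoc matrix_inverse)
  finally show ?thesis .
qed

section \<open>Kalman's conditions for observability and controllability\<close>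

text \<open>This is Kalman's rank condition for observability, in kernel form. Applied to
  \<open>transpose A\<close> and \<open>transpose B\<close> it is the rank condition for controllability.\<close>
definition separates_states :: "real^'n^'n \<Rightarrow> real^'n^'m \<Rightarrow> bool" where
  "separates_states A C \<longleftrightarrow> (\<forall>x. (\<forall>k. C *v ((*v) A ^^ k) x = 0) \<longrightarrow> x = 0)"

lemma norm_matrix_power_le:
  fixes A :: "real^'n^'n"
  shows "norm (((*v) A ^^ k) x) \<le> onorm ((*v) A) ^ k * norm x"
proof (induction k)
  case (Suc k)
  have "norm (A *v ((*v) A ^^ k) x) \<le> onorm ((*v) A) * norm (((*v) A ^^ k) x)"
    by (rule onorm) simp
  also have "\<dots> \<le> onorm ((*v) A) * (onorm ((*v) A) ^ k * norm x)"
    by (intro mult_left_mono Suc onorm_pos_le) simp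
  finally show ?case by (simp add: mult_ac)
qed simp

text \<open>The trajectory is \<open>exp (t A) x0\<close>. The last property is what both Kalman conditions need: an
  output all of whose derivatives vanish at time zero vanishes for all time.\<close>
lemma exponential_trajectory:
  fixes A :: "real^'n^'n" and x0 :: "real^'n"
  obtains \<phi> where "\<phi> 0 = x0"
    and "\<And>t. (\<phi> has_vector_derivative A *v \<phi> t) (at t)"
    and "\<And>C::real^'n^'m. (\<And>k. C *v ((*v) A ^^ k) x0 = 0) \<Longrightarrow> (\<And>t. C *v \<phi> t = 0)"
proof
  let ?v = "\<lambda>k. ((*v) A ^^ k) x0"
  \<comment> \<open>The series of \<open>exp (t A) x0\<close> is taken entry by entry, so that termwise differentiation
    of scalar power series applies.\<close>
  define c where "c = (\<lambda>i k. ?v k $ i / fact k)"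
  define \<phi> where "\<phi> = (\<lambda>t. \<chi> i. \<Sum>k. c i k * t ^ k)"
  have summ: "summable (\<lambda>k. c i k * t ^ k)" for i t
  proof (rule summable_comparison_test)
    let ?r = "onorm ((*v) A) * \<bar>t\<bar>"
    have "norm (c i k * t ^ k) \<le> norm x0 * (inverse (fact k) * ?r ^ k)" for k
    proof -
      have "\<bar>?v k $ i\<bar> \<le> onorm ((*v) A) ^ k * norm x0"
        using component_le_norm_cart norm_matrix_power_le order_trans by blast
      then have "\<bar>?v k $ i\<bar> * (\<bar>t\<bar> ^ k * inverse (fact k))
          \<le> (onorm ((*v) A) ^ k * norm x0) * (\<bar>t\<bar> ^ k * inverse (fact k))"
        by (intro mult_right_mono) simp_all
      then show ?thesis
        by (simp add: c_def abs_mult power_abs power_mult_distrib field_simps)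
    qed
    then show "\<exists>N. \<forall>k\<ge>N. norm (c i k * t ^ k) \<le> norm x0 * (inverse (fact k) * ?r ^ k)"
      by blast
    show "summable (\<lambda>k. norm x0 * (inverse (fact k) * ?r ^ k))"
      by (intro summable_mult summable_exp)
  qed
  \<comment> \<open>Any constant linear functional of the trajectory is again such a series; rows of \<open>A\<close> give
    the differential equation, rows of \<open>C\<close> the vanishing of the output.\<close>
  have lin: "(\<Sum>j\<in>UNIV. a j * \<phi> t $ j) = (\<Sum>k. (\<Sum>j\<in>UNIV. a j * ?v k $ j) / fact k * t ^ k)" for a t
  proof -
    have "(\<Sum>j\<in>UNIV. a j * \<phi> t $ j) = (\<Sum>j\<in>UNIV. \<Sum>k. a j * (c j k * t ^ k))"
      by (simp add: \<phi>_def suminf_mult summ)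
    also have "\<dots> = (\<Sum>k. \<Sum>j\<in>UNIV. a j * (c j k * t ^ k))"
      by (intro suminf_sum [symmetric] summable_mult summ)
    also have "\<dots> = (\<Sum>k. (\<Sum>j\<in>UNIV. a j * ?v k $ j) / fact k * t ^ k)"
      by (simp add: c_def sum_divide_distrib sum_distrib_right sum_distrib_left mult_ac)
    finally show ?thesis .
  qed
  have "\<phi> 0 $ i = c i 0" for i
    by (simp add: \<phi>_def powser_zero)
  then show "\<phi> 0 = x0"
    by (simp add: c_def vec_eq_iff)
  show "C *v \<phi> t = 0" if "\<And>k. C *v ?v k = 0" for C :: "real^'n^'m" and t
  proof -
    have "(\<Sum>j\<in>UNIV. C $ i $ j * ?v k $ j) = 0" for i k
      using that[of k] by (simp add: matrix_vector_mult_def vec_eq_iff)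
    then show ?thesis
      by (simp add: matrix_vector_mult_def vec_eq_iff lin)
  qed
  show "(\<phi> has_vector_derivative A *v \<phi> t) (at t)" for t
  proof -
    have "diffs (c i) k = (\<Sum>j\<in>UNIV. A $ i $ j * ?v k $ j) / fact k" for i k
      by (simp add: diffs_def c_def matrix_vector_mult_def field_simps del: of_nat_Suc)
    then have "(\<Sum>k. diffs (c i) k * t ^ k) = (A *v \<phi> t) $ i" for i
      by (simp add: matrix_vector_mult_def lin)
    then have "((\<lambda>t. \<phi> t $ i) has_real_derivative (A *v \<phi> t) $ i) (at t)" for i
      using termdiffs_strong_converges_everywhere[of "c i" t, OF summ] by (simp add: \<phi>_def)
    then have "((\<lambda>t. \<phi> t \<bullet> b) has_vector_derivative (A *v \<phi> t) \<bullet> b) (at t)"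
      if "b \<in> Basis" for b
      using that by (auto simp: Basis_vec_def cart_eq_inner_axis [symmetric]
          simp flip: has_real_derivative_iff_has_vector_derivative)
    then show ?thesis
      unfolding has_vector_derivative_def
      by (subst has_derivative_componentwise_within) simp
  qed
qed

lemma observable_imp_separates_states:
  assumes "observable A C"
  shows "separates_states A C"
  unfolding separates_states_def
proof (intro allI impI)
  fix x assume x: "\<forall>k. C *v ((*v) A ^^ k) x = 0"
  obtain \<phi> where \<phi>: "\<phi> 0 = x" "\<And>t. (\<phi> has_vector_derivative A *v \<phi> t) (at t)"
    "\<And>t. C *v \<phi> t = 0"
    using exponential_trajectory[of x A] x by metis
  obtain T where "T > 0" and T: "\<And>y z.
      (\<forall>t\<in>{0..T}. (y has_vector_derivative (A *v y t)) (at t within {0..T})) \<Longrightarrow>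
      (\<forall>t\<in>{0..T}. (z has_vector_derivative (A *v z t)) (at t within {0..T})) \<Longrightarrow>
      y 0 = 0 \<Longrightarrow> (\<forall>t\<in>{0..T}. C *v y t = C *v z t) \<Longrightarrow> z 0 = 0"
    using assms unfolding observable_def by metis
  \<comment> \<open>The trajectory from \<open>x\<close> has the same output as the one that rests at the origin.\<close>
  show "x = 0"
    using T[of "\<lambda>_. 0" \<phi>] \<phi> by (auto intro: has_vector_derivative_at_within)
qed

text \<open>A vector \<open>w\<close> that violates the dual condition is orthogonal to every state
  reachable from the origin; since \<open>w\<close> itself is reachable, it is zero.\<close>
lemma controllable_imp_separates_states_dual:
  assumes "controllable A B"
  shows "separates_states (transpose A) (transpose B)"
  unfolding separates_states_def
proof (intro allI impI)
  fix w assume w: "\<forall>k. transpose B *v ((*v) (transpose A) ^^ k) w = 0"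
  obtain \<phi> where \<phi>: "\<phi> 0 = w"
    "\<And>t. (\<phi> has_vector_derivative transpose A *v \<phi> t) (at t)"
    "\<And>t. transpose B *v \<phi> t = 0"
    using exponential_trajectory[of w "transpose A"] w by metis
  obtain T u x where T: "T > 0" and traj: "state_trajectory A B T u x" and x: "x 0 = 0" "x T = w"
    using assms unfolding controllable_def by metis
  \<comment> \<open>Pairing the trajectory with the dual one, run backwards, gives a constant: the two drift
    terms cancel and the input term is annihilated by \<open>transpose B\<close>.\<close>
  define g where "g = (\<lambda>t. \<phi> (T - t) \<bullet> x t)"
  have "(g has_vector_derivative 0) (at t within {0..T})" if "t \<in> {0..T}" for t
  proof -
    have 1: "((\<lambda>t. \<phi> (T - t)) has_vector_derivative - (transpose A *v \<phi> (T - t))) (at t within {0..T})"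
    proof -
      have "((\<lambda>t. T - t) has_vector_derivative - 1) (at t within {0..T})"
        by (auto intro!: derivative_eq_intros)
      from vector_diff_chain_within[OF this has_vector_derivative_at_within[OF \<phi>(2)]]
      show ?thesis by (simp add: o_def)
    qed
    have 2: "(x has_vector_derivative (A *v x t + B *v u t)) (at t within {0..T})"
      using traj that by (simp add: state_trajectory_def)
    have *: "v \<bullet> (M *v y) = (transpose M *v v) \<bullet> y" for M :: "real^'k^'l" and v y
      by (simp add: dot_lmul_matrix)
    have "\<phi> (T - t) \<bullet> (A *v x t + B *v u t) + (- (transpose A *v \<phi> (T - t))) \<bullet> x t = 0"
      by (simp add: inner_add_right * \<phi>(3) del: transpose_matrix_vector)
    then show ?thesis
      using bounded_bilinear.has_vector_derivative[OF bounded_bilinear_inner 1 2]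
      by (simp add: g_def)
  qed
  then obtain k where "\<And>t. t \<in> {0..T} \<Longrightarrow> g t = k"
    using has_vector_derivative_zero_constant[of "{0..T}" g] by auto
  then have "g T = g 0" using T by simp
  then show "w = 0" by (simp add: g_def x \<phi>)
qed

lemma separates_states_mult_invertible:
  assumes "separates_states A C" "invertible M"
  shows "separates_states A (M ** C)"
proof -
  obtain N where N: "N ** M = mat 1"
    using assms(2) unfolding invertible_def by blast
  have "C *v y = 0" if "(M ** C) *v y = 0" for y
  proof -
    have "N *v ((M ** C) *v y) = C *v y"
      by (simp add: matrix_vector_mul_assoc matrix_mul_assoc N)
    then show ?thesis by (simp add: that)
  qed
  then show ?thesis
    using assms(1) unfolding separates_states_def by blast
qed

section \<open>Similarity of minimal realizations\<close>

lemma linear_matrix_power: "linear ((*v) A ^^ k)" for A :: "real^'n^'n"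
proof (induction k)
  case (Suc k)
  then show ?case
    unfolding funpow.simps by (rule linear_compose) simp
qed (simp add: id_def linear_id[unfolded id_def])

lemma inner_matrix_power:
  fixes M :: "real^'n^'n"
  shows "x \<bullet> ((*v) M ^^ k) y = ((*v) (transpose M) ^^ k) x \<bullet> y"
proof (induction k arbitrary: x)
  case (Suc k)
  have "x \<bullet> ((*v) M ^^ Suc k) y = (transpose M *v x) \<bullet> ((*v) M ^^ k) y"
    by (simp add: dot_lmul_matrix)
  then show ?case
    by (simp add: Suc funpow_swap1 del: transpose_matrix_vector)
qed simp

text \<open>A vector orthogonal to all \<open>A^k B u\<close> is an unobservable state of the dual system.\<close>
lemma span_reachable_vectors:
  fixes A :: "real^'n^'n" and B :: "real^'m^'n"
  assumes "separates_states (transpose A) (transpose B)"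
  shows "span (range (\<lambda>(k, u). ((*v) A ^^ k) (B *v u))) = UNIV"
proof (rule ccontr)
  assume "span (range (\<lambda>(k, u). ((*v) A ^^ k) (B *v u))) \<noteq> UNIV"
  then obtain w where "w \<noteq> 0"
    and "\<forall>x\<in>span (range (\<lambda>(k, u). ((*v) A ^^ k) (B *v u))). w \<bullet> x = 0"
    using span_not_UNIV_orthogonal by metis
  then have "w \<bullet> ((*v) A ^^ k) (B *v u) = 0" for k u
    by (force intro: span_base)
  then have "(transpose B *v ((*v) (transpose A) ^^ k) w) \<bullet> u = 0" for k u
    by (simp add: inner_matrix_power dot_lmul_matrix)
  then have "transpose B *v ((*v) (transpose A) ^^ k) w = 0" for k
    by (metis inner_eq_zero_iff)
  then show False
    using assms \<open>w \<noteq> 0\<close> unfolding separates_states_def by metis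
qed

text \<open>Kalman's theorem that minimal realizations with equal Markov parameters are similar. The
  isomorphism has to send \<open>A1^k B1 u\<close> to \<open>A2^k B2 u\<close>; equality of the Markov parameters makes this
  consistent, since a linear relation among the former vectors produces no output on either side
  and the second system is observable.\<close>
proposition state_space_isomorphism:
  fixes A1 A2 :: "real^'n^'n" and B1 B2 :: "real^'m^'n" and C1 C2 :: "real^'n^'p"
  assumes markov: "\<And>k u. C1 *v ((*v) A1 ^^ k) (B1 *v u) = C2 *v ((*v) A2 ^^ k) (B2 *v u)"
    and obs1: "separates_states A1 C1" and obs2: "separates_states A2 C2"
    and ctr1: "separates_states (transpose A1) (transpose B1)"
  obtains T where "invertible T" "A2 ** T = T ** A1" "T ** B1 = B2" "C2 ** T = C1"
proof -
  \<comment> \<open>\<open>R\<close> pairs the states that the same input reaches in the two systems; it turns out to be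
    the graph of the isomorphism.\<close>
  define G where "G = range (\<lambda>(k, u). (((*v) A1 ^^ k) (B1 *v u), ((*v) A2 ^^ k) (B2 *v u)))"
  define R where "R = span G"
  have gen: "(((*v) A1 ^^ k) (B1 *v u), ((*v) A2 ^^ k) (B2 *v u)) \<in> R" for k u
    unfolding R_def by (rule span_base) (force simp: G_def)
  have sub: "subspace R"
    by (simp add: R_def)
  note pow_linear = linear_add[OF linear_matrix_power] linear_scale[OF linear_matrix_power]
    linear_0[OF linear_matrix_power]
  \<comment> \<open>Paired states cannot be told apart by any Markov parameter.\<close>
  have out: "C1 *v ((*v) A1 ^^ l) (fst z) = C2 *v ((*v) A2 ^^ l) (snd z)" if "z \<in> R" for z l
    using that unfolding R_def
  proof (induction rule: span_induct_alt)
    case base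
    show ?case by (simp add: pow_linear)
  next
    case (step c x y)
    obtain k u where x: "x = (((*v) A1 ^^ k) (B1 *v u), ((*v) A2 ^^ k) (B2 *v u))"
      using step(1) unfolding G_def by auto
    have "C1 *v ((*v) A1 ^^ l) (fst x) = C2 *v ((*v) A2 ^^ l) (snd x)"
      using markov[of "l + k" u] by (simp add: x funpow_add)
    then show ?case
      using step(2) by (simp add: pow_linear matrix_vector_right_distrib matrix_vector_mult_scaleR)
  qed
  have inv: "(A1 *v fst z, A2 *v snd z) \<in> R" if "z \<in> R" for z
    using that unfolding R_def
  proof (induction rule: span_induct_alt)
    case base
    show ?case by (simp add: span_zero flip: zero_prod_def)
  next
    case (step c x y)
    obtain k u where x: "x = (((*v) A1 ^^ k) (B1 *v u), ((*v) A2 ^^ k) (B2 *v u))"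
      using step(1) unfolding G_def by auto
    have "(A1 *v fst x, A2 *v snd x) \<in> span G"
      using gen[of "Suc k" u] by (simp add: x R_def)
    from span_add[OF span_scale[OF this, of c] step(2)] show ?case
      by (simp add: matrix_vector_right_distrib matrix_vector_mult_scaleR)
  qed
  have single_valued: "y = 0" if "(0, y) \<in> R" for y
  proof -
    have "C2 *v ((*v) A2 ^^ l) y = 0" for l
      using out[OF that, of l] by (simp add: pow_linear)
    then show ?thesis using obs2 by (auto simp: separates_states_def)
  qed
  have injective: "x = 0" if "(x, 0) \<in> R" for x
  proof -
    have "C1 *v ((*v) A1 ^^ l) x = 0" for l
      using out[OF that, of l] by (simp add: pow_linear)
    then show ?thesis using obs1 by (auto simp: separates_states_def)
  qed
  \<comment> \<open>Reachability of the first system makes \<open>R\<close> total.\<close>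
  have "fst ` R = span (fst ` G)"
    unfolding R_def by (rule linear_span_image [OF linear_fst, symmetric])
  also have "fst ` G = range (\<lambda>(k, u). ((*v) A1 ^^ k) (B1 *v u))"
    unfolding G_def by (force simp: image_iff)
  also have "span \<dots> = UNIV"
    by (rule span_reachable_vectors[OF ctr1])
  finally have "\<exists>y. (x, y) \<in> R" for x
    by (metis UNIV_I imageE prod.collapse)
  then obtain f where f: "\<And>x. (x, f x) \<in> R" by metis
  have f_unique: "y = f x" if "(x, y) \<in> R" for x y
    using single_valued[of "y - f x"] subspace_diff[OF sub that f[of x]] by simp
  have "linear f"
  proof (rule linearI)
    show "f (x + y) = f x + f y" for x y
      using f_unique subspace_add[OF sub f[of x] f[of y]] by simp
    show "f (c *\<^sub>R x) = c *\<^sub>R f x" for c x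
      using f_unique subspace_scale[OF sub f[of x], of c] by simp
  qed
  define T where "T = matrix f"
  have T: "T *v x = f x" for x
    using matrix_vector_mul(2)[OF \<open>linear f\<close>] by (simp add: T_def fun_eq_iff)
  show ?thesis
  proof
    have "x = 0" if "T *v x = 0" for x
      using injective f[of x] that by (simp add: T)
    then show "invertible T"
      by (simp add: invertible_left_inverse matrix_left_invertible_ker)
    have "A2 *v (T *v x) = T *v (A1 *v x)" for x
      using f_unique inv[OF f[of x]] by (simp add: T)
    then show "A2 ** T = T ** A1"
      by (simp add: matrix_eq flip: matrix_vector_mul_assoc)
    have "T *v (B1 *v u) = B2 *v u" for u
      using f_unique gen[of 0 u] by (simp add: T)
    then show "T ** B1 = B2"
      by (simp add: matrix_eq flip: matrix_vector_mul_assoc)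
    have "C2 *v (T *v x) = C1 *v x" for x
      using out[OF f[of x], of 0] by (simp add: T)
    then show "C2 ** T = C1"
      by (simp add: matrix_eq flip: matrix_vector_mul_assoc)
  qed
qed

text \<open>Two intertwiners that agree on the image of \<open>B1\<close> agree on all \<open>A1^k B1 u\<close>, which span.\<close>
lemma state_space_isomorphism_unique:
  fixes A1 A2 T T' :: "real^'n^'n" and B1 :: "real^'m^'n"
  assumes "separates_states (transpose A1) (transpose B1)"
    and "A2 ** T = T ** A1" "A2 ** T' = T' ** A1" "T ** B1 = T' ** B1"
  shows "T = T'"
proof -
  have "T *v ((*v) A1 ^^ k) (B1 *v u) = T' *v ((*v) A1 ^^ k) (B1 *v u)" for k u
  proof (induction k)
    case 0
    show ?case by (simp add: matrix_vector_mul_assoc assms(4))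
  next
    case (Suc k)
    then show ?case
      by (metis assms(2,3) funpow.simps(2) matrix_vector_mul_assoc o_apply)
  qed
  then have "T *v x = T' *v x" if "x \<in> range (\<lambda>(k, u). ((*v) A1 ^^ k) (B1 *v u))" for x
    using that by auto
  then have "T *v x = T' *v x" for x
    by (rule linear_eq_on_span[OF matrix_vector_mul_linear matrix_vector_mul_linear])
      (use span_reachable_vectors[OF assms(1)] in auto)
  then show ?thesis by (simp add: matrix_eq)
qed

section \<open>Growth of rational functions at infinity\<close>

text \<open>Growth of order at most \<open>s^d\<close> at infinity, that is, a bound on the valuation at the infinite
  place. The case \<open>d = - 1\<close> is strict properness. Zero is admitted for every \<open>d\<close>.\<close>
definition growth_le :: "int \<Rightarrow> ratfun \<Rightarrow> bool" where
  "growth_le d f \<longleftrightarrow> (\<exists>p q. q \<noteq> 0 \<and> f = to_fract p / to_fract q \<and>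
     (p = 0 \<or> int (degree p) \<le> int (degree q) + d))"

lemma growth_leI:
  assumes "q \<noteq> 0" "f * to_fract q = to_fract p" "p \<noteq> 0 \<Longrightarrow> int (degree p) \<le> int (degree q) + d"
  shows "growth_le d f"
  unfolding growth_le_def using assms
  by (intro exI[of _ p] exI[of _ q]) (auto simp: field_simps)

lemma growth_leE:
  assumes "growth_le d f"
  obtains p q where "q \<noteq> 0" "f * to_fract q = to_fract p"
    "p \<noteq> 0 \<longrightarrow> int (degree p) \<le> int (degree q) + d"
  using assms unfolding growth_le_def by (force simp: field_simps)

lemma growth_le_0 [simp]: "growth_le d 0"
  by (rule growth_leI[of 1 _ 0]) auto

lemma growth_le_add:
  assumes "growth_le d f" "growth_le d g"
  shows "growth_le d (f + g)"
proof -
  obtain p q where pq: "q \<noteq> 0" "f * to_fract q = to_fract p"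
    "p \<noteq> 0 \<longrightarrow> int (degree p) \<le> int (degree q) + d"
    using assms(1) by (rule growth_leE)
  obtain p' q' where pq': "q' \<noteq> 0" "g * to_fract q' = to_fract p'"
    "p' \<noteq> 0 \<longrightarrow> int (degree p') \<le> int (degree q') + d"
    using assms(2) by (rule growth_leE)
  show ?thesis
  proof (rule growth_leI)
    show "q * q' \<noteq> 0" using pq pq' by simp
    have "(f + g) * to_fract (q * q') = (f * to_fract q) * to_fract q' + (g * to_fract q') * to_fract q"
      by (simp add: algebra_simps)
    then show "(f + g) * to_fract (q * q') = to_fract (p * q' + p' * q)"
      by (simp add: pq pq')
    assume nz: "p * q' + p' * q \<noteq> 0"
    have dq: "int (degree (q * q')) = int (degree q) + int (degree q')"
      using pq pq' by (simp add: degree_mult_eq)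
    have a: "p \<noteq> 0 \<Longrightarrow> int (degree (p * q')) \<le> int (degree (q * q')) + d"
      using pq pq' unfolding dq by (simp add: degree_mult_eq)
    have b: "p' \<noteq> 0 \<Longrightarrow> int (degree (p' * q)) \<le> int (degree (q * q')) + d"
      using pq pq' unfolding dq by (simp add: degree_mult_eq)
    show "int (degree (p * q' + p' * q)) \<le> int (degree (q * q')) + d"
    proof (cases "p = 0 \<or> p' = 0")
      case True
      then show ?thesis using a b nz by auto
    next
      case False
      then show ?thesis using a b degree_add_le_max[of "p * q'" "p' * q"] by linarith
    qed
  qed
qed

lemma growth_le_sum: "(\<And>i. i \<in> I \<Longrightarrow> growth_le d (f i)) \<Longrightarrow> growth_le d (\<Sum>i\<in>I. f i)"
  by (induction I rule: infinite_finite_induct) (auto intro: growth_le_add)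

lemma growth_le_const_mult:
  assumes "growth_le d f"
  shows "growth_le d (const_ratfun c * f)"
proof -
  obtain p q where pq: "q \<noteq> 0" "f * to_fract q = to_fract p"
    "p \<noteq> 0 \<longrightarrow> int (degree p) \<le> int (degree q) + d"
    using assms by (rule growth_leE)
  show ?thesis
  proof (rule growth_leI[OF pq(1)])
    show "const_ratfun c * f * to_fract q = to_fract ([:c:] * p)"
      unfolding to_fract_mult pq(2)[symmetric] const_ratfun_def by (simp only: mult.assoc)
    show "int (degree ([:c:] * p)) \<le> int (degree q) + d" if "[:c:] * p \<noteq> 0"
      using that pq(3) by auto
  qed
qed

lemma growth_le_mono: "growth_le d f \<Longrightarrow> d \<le> e \<Longrightarrow> growth_le e f"
  unfolding growth_le_def by force

lemma growth_le_const: "growth_le 0 (const_ratfun c)"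
  by (rule growth_leI[of 1 _ "[:c:]"]) (auto simp: const_ratfun_def)

lemma growth_le_divide_s:
  assumes "growth_le d (ratfun_s * f)"
  shows "growth_le (d - 1) f"
proof -
  obtain p q where pq: "q \<noteq> 0" "ratfun_s * f * to_fract q = to_fract p"
    "p \<noteq> 0 \<longrightarrow> int (degree p) \<le> int (degree q) + d"
    using assms by (rule growth_leE)
  show ?thesis
  proof (rule growth_leI)
    show "[:0, 1:] * q \<noteq> 0" using pq by simp
    show "f * to_fract ([:0, 1:] * q) = to_fract p"
      using pq(2) by (simp only: to_fract_mult ratfun_s_def mult_ac)
    show "int (degree p) \<le> int (degree ([:0, 1:] * q)) + (d - 1)" if "p \<noteq> 0"
      using pq(1,3) that by (simp add: degree_mult_eq)
  qed
qed

text \<open>The bound holds for every way of writing the function as a quotient, as cross multiplication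
  of two quotients shows.\<close>
lemma growth_le_imp_degree_le:
  assumes "growth_le d f" "f * to_fract q = to_fract p" "q \<noteq> 0" "p \<noteq> 0"
  shows "int (degree p) \<le> int (degree q) + d"
proof -
  obtain p' q' where pq: "q' \<noteq> 0" "f * to_fract q' = to_fract p'"
    "p' \<noteq> 0 \<longrightarrow> int (degree p') \<le> int (degree q') + d"
    using assms(1) by (rule growth_leE)
  have "to_fract (p * q') = f * to_fract q * to_fract q'" 
    by (simp add: assms(2))
  also have "\<dots> = to_fract (p' * q)" by (simp add: pq(2)[symmetric])
  finally have eq: "p * q' = p' * q" by (simp only: to_fract_eq_iff)
  then have nz: "p' \<noteq> 0" using assms pq by auto
  have "degree p + degree q' = degree p' + degree q"
    using arg_cong[OF eq, of degree] nz assms pq by (simp add: degree_mult_eq)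
  then show ?thesis using pq(3) nz by linarith
qed

lemma ratfun_as_quotient:
  fixes f :: ratfun
  obtains p q where "q \<noteq> 0" "f * to_fract q = to_fract p"
  by (cases f rule: Fract_cases) (auto simp: Fract_conv_to_fract)

lemma growth_le_exists:
  fixes f :: ratfun
  shows "\<exists>N. \<forall>n\<ge>N. growth_le (int n) f"
proof -
  obtain p q where "q \<noteq> 0" "f * to_fract q = to_fract p" by (rule ratfun_as_quotient)
  then have "growth_le (int (degree p)) f"
    by (rule growth_leI) simp
  then show ?thesis by (intro exI[of _ "degree p"]) (auto intro: growth_le_mono)
qed

lemma growth_le_all_imp_0:
  assumes "\<And>d. growth_le d f"
  shows "f = 0"
proof (rule ccontr)
  assume f: "f \<noteq> 0"
  obtain p q where pq: "q \<noteq> 0" "f * to_fract q = to_fract p" by (rule ratfun_as_quotient)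
  then have "p \<noteq> 0" using f by auto
  \<comment> \<open>This bound would make the degree of \<open>p\<close> negative.\<close>
  from growth_le_imp_degree_le[OF assms[of "- int (degree q) - 1"] pq(2,1) this] show False by simp
qed

lemma const_ratfun_strictly_proper:
  assumes "growth_le (- 1) (const_ratfun c)"
  shows "c = 0"
  using growth_le_imp_degree_le[OF assms, of 1 "[:c:]"] by (auto simp: const_ratfun_def)

section \<open>Constant matrices over the rational functions\<close>

lemma const_ratfun_simps [simp]:
  "const_ratfun 0 = 0" "const_ratfun 1 = 1"
  "const_ratfun (a + b) = const_ratfun a + const_ratfun b"
  "const_ratfun (a - b) = const_ratfun a - const_ratfun b"
  "const_ratfun (a * b) = const_ratfun a * const_ratfun b"
  by (simp_all add: const_ratfun_def flip: to_fract_add to_fract_diff to_fract_mult one_pCons)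

lemma const_ratfun_sum: "const_ratfun (\<Sum>i\<in>I. f i) = (\<Sum>i\<in>I. const_ratfun (f i))"
  by (induction I rule: infinite_finite_induct) auto

lemma const_matrix_mult: "const_matrix (M ** N) = const_matrix M ** const_matrix N"
  by (simp add: const_matrix_def vec_eq_iff matrix_matrix_mult_def const_ratfun_sum)

lemma const_matrix_transpose: "const_matrix (transpose M) = transpose (const_matrix M)"
  by (simp add: const_matrix_def vec_eq_iff transpose_def)

lemma const_matrix_mat_1 [simp]: "const_matrix (mat 1) = mat 1"
  by (simp add: const_matrix_def vec_eq_iff mat_def)

text \<open>The constant term is the value at infinity.\<close>
lemma proper_part_unique:
  assumes eq: "const_matrix M + Z = const_matrix M' + Z'"
    and Z: "\<And>i j. growth_le (- 1) (Z $ i $ j)" and Z': "\<And>i j. growth_le (- 1) (Z' $ i $ j)"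
  shows "M = M'" "Z = Z'"
proof -
  have "M $ i $ j - M' $ i $ j = 0" for i j
  proof (rule const_ratfun_strictly_proper)
    \<comment> \<open>The difference of the constants is also a difference of strictly proper entries.\<close>
    have "const_ratfun (- 1) = - 1"
      using const_ratfun_simps(4)[of 0 1] by simp
    moreover have "const_ratfun (M $ i $ j) + Z $ i $ j = const_ratfun (M' $ i $ j) + Z' $ i $ j"
      using arg_cong[OF eq, of "\<lambda>N. N $ i $ j"] by (simp add: const_matrix_def)
    ultimately have "const_ratfun (M $ i $ j - M' $ i $ j) = Z' $ i $ j + const_ratfun (- 1) * Z $ i $ j"
      by (simp add: algebra_simps)
    then show "growth_le (- 1) (const_ratfun (M $ i $ j - M' $ i $ j))"
      using growth_le_add[OF Z' growth_le_const_mult[OF Z]] by metis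
  qed
  then show "M = M'" by (simp add: vec_eq_iff)
  then show "Z = Z'" using eq by simp
qed

lemma growth_le_const_matrix_mult:
  assumes "\<And>i j. growth_le d (X $ i $ j)"
  shows "growth_le d ((const_matrix M ** X) $ i $ j)"
  by (auto simp: matrix_matrix_mult_def const_matrix_def
      intro!: growth_le_sum growth_le_const_mult assms)

section \<open>Resolvent and transfer function\<close>

text \<open>In \<open>s X = Y + A X\<close>, a bound \<open>e \<ge> d\<close> on \<open>X\<close> bounds the right-hand side by \<open>e\<close>, and dividing by
  \<open>s\<close> improves the bound on \<open>X\<close> to \<open>e - 1\<close>. Repeating this leads down to \<open>d - 1\<close>.\<close>
lemma growth_le_of_recurrence:
  fixes A :: "real^'n^'n" and X :: "ratfun^'m^'n"
  assumes "mat ratfun_s ** X = Y + const_matrix A ** X"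
    and "\<And>i j. growth_le d (Y $ i $ j)"
  shows "growth_le (d - 1) (X $ i $ j)"
proof -
  have step: "growth_le (e - 1) (X $ i $ j)"
    if "\<And>i j. growth_le e (X $ i $ j)" "d \<le> e" for e i j
  proof (rule growth_le_divide_s)
    have "ratfun_s * X $ i $ j = Y $ i $ j + (const_matrix A ** X) $ i $ j"
      by (metis assms(1) mat_mult_entry vector_add_component)
    also have "growth_le e \<dots>"
      by (auto simp: matrix_matrix_mult_def const_matrix_def that
          intro!: growth_le_add growth_le_sum growth_le_const_mult
            growth_le_mono[OF assms(2) \<open>d \<le> e\<close>])
    finally show "growth_le e (ratfun_s * X $ i $ j)" .
  qed
  \<comment> \<open>Some bound holds for all entries at once; it is then lowered one step at a time.\<close>
  obtain N where N: "\<And>i j n. n \<ge> N i j \<Longrightarrow> growth_le (int n) (X $ i $ j)"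
    using growth_le_exists[of "X $ i $ j" for i j] by metis
  define K where "K = (\<Sum>i\<in>UNIV. \<Sum>j\<in>UNIV. N i j)"
  have "N i j \<le> K" for i j
  proof -
    have "N i j \<le> (\<Sum>j\<in>UNIV. N i j)" by (rule member_le_sum) auto
    also have "\<dots> \<le> K" unfolding K_def by (rule member_le_sum[of i]) auto
    finally show ?thesis .
  qed
  then have "growth_le (int K) (X $ i $ j)" for i j
    by (rule N)
  then have K: "growth_le (int K + \<bar>d\<bar>) (X $ i $ j)" for i j
    by (rule growth_le_mono) simp
  have "growth_le (int K + \<bar>d\<bar> - int k) (X $ i $ j)"
    if "int K + \<bar>d\<bar> - int k \<ge> d - 1" for k i j
    using that
  proof (induction k arbitrary: i j)
    case (Suc k)
    then show ?case
      using step[of "int K + \<bar>d\<bar> - int k" i j] by (simp add: algebra_simps)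
  qed (use K in simp)
  from this[of "nat (int K + \<bar>d\<bar> - d + 1)"] show ?thesis by simp
qed

lemma resolvent_invertible:
  fixes A :: "real^'n^'n"
  shows "invertible (mat ratfun_s - const_matrix A)"
proof -
  have "v = 0" if v: "(mat ratfun_s - const_matrix A) *v v = 0" for v
  proof -
    \<comment> \<open>A kernel vector, written as a one-column matrix, satisfies the recurrence with no
      inhomogeneous term, so its growth can be lowered without end.\<close>
    define X :: "ratfun^unit^'n" where "X = columnvector v"
    have X: "mat ratfun_s ** X = 0 + const_matrix A ** X"
    proof -
      have "(M ** X) $ i $ j = (M *v v) $ i" for M :: "ratfun^'n^'n" and i j
        by (simp add: X_def columnvector_def matrix_matrix_mult_def matrix_vector_mult_def)
      then have "(mat ratfun_s - const_matrix A) ** X = 0"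
        by (simp add: vec_eq_iff v)
      then show ?thesis by (simp add: matrix_diff_rdistrib)
    qed
    have "growth_le d (X $ i $ j)" for d i j
      using growth_le_of_recurrence[OF X, of "d + 1"] by simp
    then have "X = 0"
      using growth_le_all_imp_0 by (simp add: vec_eq_iff)
    then show "v = 0" by (simp add: X_def columnvector_def vec_eq_iff)
  qed
  then show ?thesis
    by (simp add: invertible_left_inverse matrix_left_invertible_ker)
qed

lemma resolvent_strictly_proper:
  fixes A :: "real^'n^'n" and B :: "real^'m^'n"
  defines "X \<equiv> matrix_inv (mat ratfun_s - const_matrix A) ** const_matrix B"
  shows "mat ratfun_s ** X = const_matrix B + const_matrix A ** X"
    and "growth_le (- 1) (X $ i $ j)"
proof -
  have "(mat ratfun_s - const_matrix A) ** X = const_matrix B"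
    by (simp add: X_def matrix_mul_assoc matrix_inverse resolvent_invertible)
  then show eq: "mat ratfun_s ** X = const_matrix B + const_matrix A ** X"
    by (simp add: matrix_diff_rdistrib algebra_simps)
  show "growth_le (- 1) (X $ i $ j)"
    using growth_le_of_recurrence[OF eq, of 0]
    by (simp add: const_matrix_def growth_le_const)
qed

text \<open>Powers of \<open>A\<close> are iterated maps on states; on output matrices they act from the right.\<close>
lemma right_matrix_power:
  fixes A :: "real^'n^'n" and C :: "real^'n^'m"
  shows "((\<lambda>M. M ** A) ^^ k) C *v x = C *v ((*v) A ^^ k) x"
proof (induction k arbitrary: x)
  case (Suc k)
  have "((\<lambda>M. M ** A) ^^ Suc k) C *v x = ((\<lambda>M. M ** A) ^^ k) C *v (A *v x)"
    by (simp flip: matrix_vector_mul_assoc)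
  also have "\<dots> = C *v ((*v) A ^^ Suc k) x"
    by (simp add: Suc funpow_swap1)
  finally show ?case .
qed simp

text \<open>With \<open>Z k = C A^k (s I - A)^-1 B\<close> one has \<open>s Z k = C A^k B + Z (k + 1)\<close>, and every \<open>Z k\<close> is
  strictly proper. Separating the value at infinity from the strictly proper remainder therefore
  reads off \<open>D\<close> and then the Markov parameters \<open>C A^k B\<close> one after another.\<close>
proposition transfer_function_determines_markov_parameters:
  fixes A1 :: "real^'n^'n" and A2 :: "real^'k^'k"
  assumes eq: "transfer_function A1 B1 C1 D1 = transfer_function A2 B2 C2 D2"
  shows "D1 = D2" and "C1 *v ((*v) A1 ^^ l) (B1 *v u) = C2 *v ((*v) A2 ^^ l) (B2 *v u)"
proof -
  define X1 where "X1 = matrix_inv (mat ratfun_s - const_matrix A1) ** const_matrix B1"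
  define X2 where "X2 = matrix_inv (mat ratfun_s - const_matrix A2) ** const_matrix B2"
  \<comment> \<open>\<open>L1 k\<close> and \<open>L2 k\<close> are \<open>C1 A1^k\<close> and \<open>C2 A2^k\<close>.\<close>
  define L1 where "L1 = (\<lambda>k. ((\<lambda>M. M ** A1) ^^ k) C1)"
  define L2 where "L2 = (\<lambda>k. ((\<lambda>M. M ** A2) ^^ k) C2)"
  note X1 = resolvent_strictly_proper[of A1 B1, folded X1_def]
  note X2 = resolvent_strictly_proper[of A2 B2, folded X2_def]
  have proper1: "growth_le (- 1) ((const_matrix M ** X1) $ i $ j)" for M :: "real^'n^'p" and i j
    by (intro growth_le_const_matrix_mult X1)
  have proper2: "growth_le (- 1) ((const_matrix M ** X2) $ i $ j)" for M :: "real^'k^'p" and i j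
    by (intro growth_le_const_matrix_mult X2)
  have shift: "mat ratfun_s ** (const_matrix L ** X) = const_matrix (L ** B) + const_matrix (L ** A) ** X"
    if "mat ratfun_s ** X = const_matrix B + const_matrix A ** X"
    for L :: "real^'q^'p" and X and A :: "real^'q^'q" and B :: "real^'r^'q"
  proof -
    have "mat ratfun_s ** (const_matrix L ** X) = const_matrix L ** (mat ratfun_s ** X)"
      by (simp add: mat_commute[of _ "const_matrix L"] matrix_mul_assoc)
    then show ?thesis
      by (simp add: that matrix_add_ldistrib const_matrix_mult matrix_mul_assoc)
  qed
  have start: "const_matrix D1 + const_matrix C1 ** X1 = const_matrix D2 + const_matrix C2 ** X2"
    using eq by (simp add: transfer_function_def X1_def X2_def matrix_mul_assoc add.commute)
  then show "D1 = D2"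
    by (rule proper_part_unique(1)[OF _ proper1 proper2])
  have step: "L1 l ** B1 = L2 l ** B2 \<and> const_matrix (L1 (Suc l)) ** X1 = const_matrix (L2 (Suc l)) ** X2"
    if "const_matrix (L1 l) ** X1 = const_matrix (L2 l) ** X2" for l
  proof -
    have "const_matrix (L1 l ** B1) + const_matrix (L1 (Suc l)) ** X1
        = const_matrix (L2 l ** B2) + const_matrix (L2 (Suc l)) ** X2"
      using shift[OF X1(1), of "L1 l"] shift[OF X2(1), of "L2 l"] that by (simp add: L1_def L2_def)
    from proper_part_unique[OF this proper1 proper2] show ?thesis by simp
  qed
  have "const_matrix (L1 l) ** X1 = const_matrix (L2 l) ** X2" for l
  proof (induction l)
    case 0
    show ?case
      using proper_part_unique(2)[OF start proper1 proper2] by (simp add: L1_def L2_def)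
  qed (use step in blast)
  with step have "L1 l ** B1 = L2 l ** B2" by blast
  then have "L1 l *v (B1 *v u) = L2 l *v (B2 *v u)"
    by (simp add: matrix_vector_mul_assoc)
  then show "C1 *v ((*v) A1 ^^ l) (B1 *v u) = C2 *v ((*v) A2 ^^ l) (B2 *v u)"
    by (simp add: L1_def L2_def right_matrix_power)
qed

text \<open>\<open>T\<close> also intertwines the resolvents.\<close>
lemma transfer_function_eq_if_intertwined:
  fixes A1 :: "real^'n^'n" and A2 :: "real^'k^'k"
  assumes AT: "A2 ** T = T ** A1" and "T ** B1 = B2" "C2 ** T = C1"
  shows "transfer_function A1 B1 C1 D = transfer_function A2 B2 C2 D"
proof -
  let ?R1 = "mat ratfun_s - const_matrix A1" and ?R2 = "mat ratfun_s - const_matrix A2"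
  have "?R2 ** const_matrix T = const_matrix T ** ?R1"
    by (simp add: matrix_diff_rdistrib matrix_diff_ldistrib mat_commute AT flip: const_matrix_mult)
  then have comm: "matrix_inv ?R2 ** (?R2 ** const_matrix T) ** matrix_inv ?R1
      = matrix_inv ?R2 ** (const_matrix T ** ?R1) ** matrix_inv ?R1"
    by simp
  have "matrix_inv ?R2 ** (?R2 ** const_matrix T) = const_matrix T"
    by (simp add: matrix_mul_assoc matrix_inverse resolvent_invertible)
  moreover have "(const_matrix T ** ?R1) ** matrix_inv ?R1 = const_matrix T"
    by (simp add: matrix_inverse resolvent_invertible flip: matrix_mul_assoc)
  ultimately have T: "const_matrix T ** matrix_inv ?R1 = matrix_inv ?R2 ** const_matrix T"
    using comm by (metis matrix_mul_assoc)
  have "const_matrix C1 ** matrix_inv ?R1 ** const_matrix B1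
      = const_matrix C2 ** (const_matrix T ** matrix_inv ?R1) ** const_matrix B1"
    by (simp add: matrix_mul_assoc const_matrix_mult flip: assms(3))
  also have "\<dots> = const_matrix C2 ** matrix_inv ?R2 ** const_matrix B2"
    by (simp add: T matrix_mul_assoc const_matrix_mult flip: assms(2))
  finally show ?thesis by (simp add: transfer_function_def)
qed

lemma transpose_transfer_function:
  "transpose (transfer_function A B C D)
    = transfer_function (transpose A) (transpose C) (transpose B) (transpose D)"
proof -
  let ?R = "mat ratfun_s - const_matrix A"
  have "matrix_inv (transpose ?R) = transpose (matrix_inv ?R)"
    by (rule matrix_inv_unique)
      (simp_all add: matrix_inverse resolvent_invertible transpose_mat flip: matrix_transpose_mul)
  moreover have "transpose ?R = mat ratfun_s - const_matrix (transpose A)"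
    by (simp add: transpose_diff const_matrix_transpose transpose_mat)
  ultimately show ?thesis
    by (simp add: transfer_function_def transpose_add matrix_transpose_mul const_matrix_transpose
        matrix_mul_assoc)
qed

lemma transfer_function_mult_const:
  "transfer_function A B C D ** const_matrix M = transfer_function A (B ** M) C (D ** M)"
  by (simp add: transfer_function_def matrix_add_rdistrib const_matrix_mult matrix_mul_assoc)

lemma const_mult_transfer_function:
  "const_matrix M ** transfer_function A B C D = transfer_function A B (M ** C) (M ** D)"
  by (simp add: transfer_function_def matrix_add_ldistrib const_matrix_mult matrix_mul_assoc)

section \<open>Sylvester's law of inertia\<close>

text \<open>Gram-Schmidt for a symmetric bilinear form that may be indefinite or degenerate, by induction
  on the dimension of the subspace. The subspace is general because the induction passes to
  orthogonal complements.\<close>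
lemma symmetric_form_orthogonal_basis:
  fixes M :: "real^'n^'n"
  assumes sym: "transpose M = M" and "subspace S"
  shows "\<exists>B. B \<subseteq> S \<and> independent B \<and> span B = S \<and> pairwise (\<lambda>x y. x \<bullet> (M *v y) = 0) B"
  using \<open>subspace S\<close>
proof (induction "dim S" arbitrary: S rule: less_induct)
  case less
  have comm: "x \<bullet> (M *v y) = y \<bullet> (M *v x)" for x y
    by (metis dot_lmul_matrix inner_commute sym transpose_matrix_vector)
  show ?case
  proof (cases "\<forall>x\<in>S. x \<bullet> (M *v x) = 0")
    case True
    \<comment> \<open>By polarization the whole form vanishes on \<open>S\<close>, and any basis will do.\<close>
    have "x \<bullet> (M *v y) = 0" if "x \<in> S" "y \<in> S" for x y
    proof -
      have "(x + y) \<bullet> (M *v (x + y)) = 0"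
        using True that less.prems by (simp add: subspace_add)
      then show ?thesis
        using True that comm[of x y]
        by (simp add: matrix_vector_mult_add_rdistrib matrix_vector_right_distrib inner_add_left inner_add_right)
    qed
    moreover obtain B where "B \<subseteq> S" "independent B" "S \<subseteq> span B"
      using basis_exists[of S] by metis
    ultimately show ?thesis
      using less.prems span_minimal[of B S] unfolding pairwise_def by (metis subset_antisym subsetD)
  next
    case False
    then obtain x where x: "x \<in> S" "x \<bullet> (M *v x) \<noteq> 0" by auto
    \<comment> \<open>Split off \<open>x\<close>: its orthogonal complement for the form misses \<open>x\<close>, so it is smaller.\<close>
    define S' where "S' = {y \<in> S. x \<bullet> (M *v y) = 0}"
    have sub': "subspace S'"
      using less.prems unfolding S'_def subspace_def
      by (auto simp: matrix_vector_right_distrib inner_add_right matrix_vector_mult_scaleR)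
    have "dim S' < dim S"
    proof (rule dim_psubset)
      have "S' \<subset> S" using x by (auto simp: S'_def)
      then show "span S' \<subset> span S"
        using sub' less.prems by (metis span_eq_iff)
    qed
    from less.hyps[OF this sub'] obtain B where
      B: "B \<subseteq> S'" "independent B" "span B = S'" "pairwise (\<lambda>x y. x \<bullet> (M *v y) = 0) B"
      by auto
    show ?thesis
    proof (intro exI[of _ "insert x B"] conjI)
      show "insert x B \<subseteq> S" using x B by (auto simp: S'_def)
      show "independent (insert x B)"
        using B x by (intro independent_insertI) (auto simp: S'_def)
      show "pairwise (\<lambda>x y. x \<bullet> (M *v y) = 0) (insert x B)"
        using B comm by (auto simp: pairwise_insert S'_def subset_iff)
      show "span (insert x B) = S"
      proof
        show "span (insert x B) \<subseteq> S"
          using \<open>insert x B \<subseteq> S\<close> less.prems by (rule span_minimal)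
        show "S \<subseteq> span (insert x B)"
        proof
          fix y assume y: "y \<in> S"
          define k where "k = (x \<bullet> (M *v y)) / (x \<bullet> (M *v x))"
          have "y - k *\<^sub>R x \<in> S'"
            using x y less.prems unfolding S'_def
            by (auto simp: subspace_diff subspace_scale matrix_vector_mult_diff_distrib
                matrix_vector_mult_scaleR inner_diff_right k_def)
          then show "y \<in> span (insert x B)"
            unfolding span_insert using B by auto
        qed
      qed
    qed
  qed
qed

lemma congruence_entry:
  fixes M :: "real^'n^'n" and V :: "real^'n^'n"
  shows "(transpose V ** M ** V) $ i $ j = column i V \<bullet> (M *v column j V)"
proof -
  have "(transpose V ** (M ** V)) $ i $ j = column i V \<bullet> (M *v column j V)"
    by (simp add: matrix_matrix_mult_def matrix_vector_mult_def transpose_def column_def inner_vec_def)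
  then show ?thesis by (simp add: matrix_mul_assoc)
qed

lemma signature_matrix_square:
  assumes "signature_matrix S"
  shows "S ** S = mat 1" "transpose S = S"
proof -
  have "S $ i $ k * S $ k $ j = (if k = i then (if i = j then 1 else 0) else 0)" for i j k
    using assms unfolding signature_matrix_def by (metis mult_eq_0_iff mult_1 minus_mult_minus)
  then show "S ** S = mat 1"
    by (simp add: matrix_matrix_mult_def mat_def vec_eq_iff)
  show "transpose S = S"
    using assms unfolding signature_matrix_def transpose_def vec_eq_iff by simp metis
qed

text \<open>Sylvester's law of inertia, existence part: in a basis orthogonal for the form of \<open>M\<close> the form
  is diagonal with non-zero entries \<open>d\<close>, and dividing the vectors by \<open>sqrt \<bar>d\<bar>\<close> turns these into signs.\<close>
lemma symmetric_congruent_to_signature: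
  fixes M :: "real^'n^'n"
  assumes sym: "transpose M = M" and inv: "invertible M"
  obtains K S :: "real^'n^'n" where "invertible K" "signature_matrix S" "M = K ** S ** transpose K"
proof -
  obtain B where B: "independent B" "span B = UNIV" "pairwise (\<lambda>x y. x \<bullet> (M *v y) = 0) B"
    using symmetric_form_orthogonal_basis[OF sym subspace_UNIV] by auto
  have "card B = CARD('n)"
    using B by (metis dim_UNIV dim_eq_card_independent dim_span DIM_cart DIM_real mult_1_right)
  then obtain f :: "'n \<Rightarrow> real^'n" where f: "bij_betw f UNIV B"
    by (metis B(1) finite_same_card_bij finite_UNIV independent_imp_finite finite)
  define d where "d = (\<lambda>i. f i \<bullet> (M *v f i))"
  have orth: "f i \<bullet> (M *v f j) = 0" if "i \<noteq> j" for i j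
    using B(3) f that unfolding pairwise_def bij_betw_def by (metis UNIV_I image_eqI injD)
  \<comment> \<open>A basis vector with \<open>d i = 0\<close> would be orthogonal to everything, hence in the kernel.\<close>
  have d: "d i \<noteq> 0" for i
  proof
    assume "d i = 0"
    then have "f j \<bullet> (M *v f i) = 0" for j
      using orth[of j i] by (cases "i = j") (auto simp: d_def)
    then have "\<forall>b\<in>B. b \<bullet> (M *v f i) = 0"
      using f by (force simp: bij_betw_def)
    then have "\<forall>y. (M *v f i) \<bullet> y = 0"
      using B(2) orthogonal_to_span[of _ B "M *v f i"] by (auto simp: orthogonal_def inner_commute)
    then have "M *v f i = 0" by (metis inner_eq_zero_iff)
    then have "f i = 0"
      using inv by (metis invertible_left_inverse matrix_left_invertible_ker)
    moreover have "f i \<in> B" using f by (auto simp: bij_betw_def)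
    ultimately show False using B(1) dependent_zero by metis
  qed
  define V :: "real^'n^'n" where "V = (\<chi> i j. f j $ i / sqrt \<bar>d j\<bar>)"
  have col: "column j V = (1 / sqrt \<bar>d j\<bar>) *\<^sub>R f j" for j
    by (simp add: V_def column_def vec_eq_iff)
  define S where "S = transpose V ** M ** V"
  have S: "S $ i $ j = (if i = j then sgn (d i) else 0)" for i j
  proof -
    have "S $ i $ j = f i \<bullet> (M *v f j) / (sqrt \<bar>d i\<bar> * sqrt \<bar>d j\<bar>)"
      by (simp add: S_def congruence_entry col matrix_vector_mult_scaleR)
    moreover have "d i / (sqrt \<bar>d i\<bar> * sqrt \<bar>d i\<bar>) = sgn (d i)"
      using d[of i] by (simp add: sgn_div_norm divide_inverse mult.commute)
    ultimately show ?thesis using orth by (auto simp: d_def)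
  qed
  have sig: "signature_matrix S"
    using d by (auto simp: signature_matrix_def S sgn_if)
  have "S ** S = mat 1"
  proof -
    have "(\<Sum>k\<in>UNIV. S $ i $ k * S $ k $ j) = (\<Sum>k\<in>UNIV. if k = i then (if i = j then 1 else 0) else 0)" for i j
      using d by (intro sum.cong) (auto simp: S sgn_if)
    then show ?thesis
      by (simp add: matrix_matrix_mult_def mat_def vec_eq_iff)
  qed
  then have "(S ** transpose V ** M) ** V = mat 1"
    by (simp add: S_def matrix_mul_assoc)
  then have invV: "invertible V"
    by (auto simp: invertible_left_inverse)
  then obtain W where W: "V ** W = mat 1" "W ** V = mat 1"
    by (auto simp: invertible_def)
  have "transpose W ** S ** W = transpose (V ** W) ** M ** (V ** W)"
    by (simp add: S_def matrix_transpose_mul matrix_mul_assoc)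
  then have "M = transpose W ** S ** transpose (transpose W)"
    by (simp add: W transpose_mat)
  moreover have "invertible (transpose W)"
    using W by (intro transpose_invertible) (auto simp: invertible_def)
  ultimately show ?thesis using that sig by blast
qed

section \<open>Symmetrizability and block matrices\<close>

text \<open>The matrices \<open>K\<close> and \<open>S\<close> of the definition enter only through \<open>M = K S K\<^sup>T\<close>, and by Sylvester's
  law every invertible symmetric \<open>M\<close> arises in this way.\<close>
lemma symmetrizable_iff_symmetric_intertwiner:
  fixes G :: "ratfun^'m^'m"
  shows "symmetrizable G \<longleftrightarrow> (\<exists>M. invertible M \<and> transpose M = M \<and>
     G ** const_matrix M = const_matrix M ** transpose G)"
proof
  assume "symmetrizable G"
  then obtain K S :: "real^'m^'m" where K: "invertible K" and S: "signature_matrix S"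
    and HS: "const_matrix S ** transpose (const_matrix (matrix_inv K) ** G ** const_matrix K)
      = const_matrix (matrix_inv K) ** G ** const_matrix K ** const_matrix S"
    unfolding symmetrizable_def symmetric_system_def by blast
  let ?k = "const_matrix K" and ?l = "const_matrix (matrix_inv K)" and ?s = "const_matrix S"
  have kl: "?k ** ?l = mat 1" "transpose ?l ** transpose ?k = mat 1"
    using K by (simp_all add: matrix_inverse transpose_mat flip: const_matrix_mult matrix_transpose_mul)
  define M where "M = K ** S ** transpose K"
  have "G ** const_matrix M = (?k ** ?l) ** G ** ?k ** ?s ** transpose ?k"
    by (simp only: kl) (simp add: M_def const_matrix_mult const_matrix_transpose matrix_mul_assoc)
  also have "\<dots> = ?k ** (?l ** G ** ?k ** ?s) ** transpose ?k"
    by (simp only: matrix_mul_assoc)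
  also have "\<dots> = ?k ** ?s ** transpose ?k ** transpose G ** (transpose ?l ** transpose ?k)"
    by (simp only: HS[symmetric] matrix_transpose_mul matrix_mul_assoc)
  also have "\<dots> = const_matrix M ** transpose G"
    by (simp only: kl) (simp add: M_def const_matrix_mult const_matrix_transpose matrix_mul_assoc)
  finally have "G ** const_matrix M = const_matrix M ** transpose G" .
  moreover have "transpose M = M"
    by (simp add: M_def matrix_transpose_mul signature_matrix_square[OF S] matrix_mul_assoc)
  moreover have "invertible M"
    unfolding M_def using K signature_matrix_square[OF S]
    by (intro invertible_mult transpose_invertible) (auto simp: invertible_def)
  ultimately show "\<exists>M. invertible M \<and> transpose M = M \<and>
     G ** const_matrix M = const_matrix M ** transpose G" by blast
next
  assume "\<exists>M. invertible M \<and> transpose M = M \<and> G ** const_matrix M = const_matrix M ** transpose G"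
  then obtain M where M: "invertible M" "transpose M = M"
    and GM: "G ** const_matrix M = const_matrix M ** transpose G" by blast
  obtain K S :: "real^'m^'m"
    where K: "invertible K" and S: "signature_matrix S" and MK: "M = K ** S ** transpose K"
    using symmetric_congruent_to_signature[OF M(2,1)] .
  let ?k = "const_matrix K" and ?l = "const_matrix (matrix_inv K)" and ?s = "const_matrix S"
  have lk: "?l ** ?k = mat 1" "transpose ?k ** transpose ?l = mat 1"
    using K by (simp_all add: matrix_inverse transpose_mat flip: const_matrix_mult matrix_transpose_mul)
  have m: "const_matrix M = ?k ** ?s ** transpose ?k"
    by (simp add: MK const_matrix_mult const_matrix_transpose)
  have "?l ** G ** ?k ** ?s = ?l ** G ** ?k ** ?s ** (transpose ?k ** transpose ?l)"
    by (simp add: lk)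
  also have "\<dots> = ?l ** (G ** const_matrix M) ** transpose ?l"
    by (simp only: m matrix_mul_assoc)
  also have "\<dots> = (?l ** ?k) ** ?s ** transpose ?k ** transpose G ** transpose ?l"
    unfolding GM by (simp only: m matrix_mul_assoc)
  also have "\<dots> = ?s ** transpose (?l ** G ** ?k)"
    by (simp add: lk matrix_transpose_mul matrix_mul_assoc)
  finally have HS: "?l ** G ** ?k ** ?s = ?s ** transpose (?l ** G ** ?k)" .
  have "symmetric_system (?l ** G ** ?k)"
    unfolding symmetric_system_def by (intro exI[of _ S] conjI S HS[symmetric])
  with K show "symmetrizable G"
    unfolding symmetrizable_def by (intro exI[of _ K] conjI)
qed

lemma system_matrix_mult:
  "system_matrix A B C D ** system_matrix A' B' C' D'
    = system_matrix (A ** A' + B ** C') (A ** B' + B ** D') (C ** A' + D ** C') (C ** B' + D ** D')"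
  by (simp add: system_matrix_def matrix_matrix_mult_def vec_eq_iff sum.Plus split: sum.split
      flip: UNIV_Plus_UNIV)

lemma transpose_system_matrix:
  "transpose (system_matrix A B C D)
    = system_matrix (transpose A) (transpose C) (transpose B) (transpose D)"
  by (simp add: system_matrix_def transpose_def vec_eq_iff split: sum.split)

lemma system_matrix_eq_iff:
  "system_matrix A B C D = system_matrix A' B' C' D' \<longleftrightarrow> A = A' \<and> B = B' \<and> C = C' \<and> D = D'"
  by (simp add: system_matrix_def vec_eq_iff split_sum_all)  blast

lemma mat_1_system_matrix: "mat 1 = system_matrix (mat 1) 0 0 (mat 1)"
  by (simp add: system_matrix_def mat_def vec_eq_iff split: sum.split)

lemma system_matrix_cases:
  fixes Q :: "real^('n::finite + 'm::finite)^('n + 'm)"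
  obtains A B C D where "Q = system_matrix A B C D" 
  by (rule that[of "\<chi> i j. Q $ Inl i $ Inl j" "\<chi> i j. Q $ Inl i $ Inr j"
        "\<chi> i j. Q $ Inr i $ Inl j" "\<chi> i j. Q $ Inr i $ Inr j"])
    (simp add: system_matrix_def vec_eq_iff split: sum.split)

lemma upper_right_block_system_matrix [simp]: "upper_right_block (system_matrix A B C D) = B"
  by (simp add: upper_right_block_def system_matrix_def vec_eq_iff)

lemma invertible_block_diagonal:
  "invertible (system_matrix A 0 0 D) \<longleftrightarrow> invertible A \<and> invertible D"
proof
  assume "invertible (system_matrix A 0 0 D)"
  then obtain N where "system_matrix A 0 0 D ** N = mat 1"
    unfolding invertible_def by blast
  moreover obtain W X Y Z where "N = system_matrix W X Y Z"
    by (rule system_matrix_cases)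
  ultimately have "A ** W = mat 1" "D ** Z = mat 1"
    by (simp_all add: system_matrix_mult mat_1_system_matrix system_matrix_eq_iff)
  then show "invertible A \<and> invertible D"
    by (auto simp: invertible_right_inverse)
next
  assume "invertible A \<and> invertible D"
  then obtain W Z where "A ** W = mat 1" "D ** Z = mat 1"
    by (auto simp: invertible_def)
  then have "system_matrix A 0 0 D ** system_matrix W 0 0 Z = mat 1"
    by (simp add: system_matrix_mult mat_1_system_matrix)
  then show "invertible (system_matrix A 0 0 D)"
    by (auto simp: invertible_right_inverse)
qed

section \<open>Symmetrizability through the system matrix\<close>

theorem theorem1:
  fixes A :: "real^'n^'n" and B :: "real^'m^'n" and C :: "real^'n^'m" and D :: "real^'m^'m"
    and P :: "real^('n + 'm)^('n + 'm)"
  assumes "minimal_system A B C"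
    and "P = system_matrix A B C D"
  shows "symmetrizable (transfer_function A B C D) \<longleftrightarrow>
    (\<exists>Q :: real^('n + 'm)^('n + 'm). invertible Q \<and>
       P ** Q = Q ** transpose P \<and> Q = transpose Q \<and> upper_right_block Q = 0)"
proof
  assume "symmetrizable (transfer_function A B C D)"
  then obtain M where M: "invertible M" "transpose M = M"
    and eq: "transfer_function A (B ** M) C (D ** M)
      = transfer_function (transpose A) (transpose C) (M ** transpose B) (M ** transpose D)"
    unfolding symmetrizable_iff_symmetric_intertwiner
    by (auto simp: transpose_transfer_function transfer_function_mult_const const_mult_transfer_function)
  \<comment> \<open>\<open>eq\<close> is the intertwining relation, read as an equality between the transfer functions of
    two realizations: the given one with its input rescaled by \<open>M\<close>, and the transposed one with
    its output rescaled by \<open>M\<close>.\<close>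
  have obs: "separates_states A C" and ctr: "separates_states (transpose A) (transpose B)"
    using assms(1) observable_imp_separates_states controllable_imp_separates_states_dual
    unfolding minimal_system_def by blast+
  note markov = transfer_function_determines_markov_parameters[OF eq]
  obtain T where T: "invertible T" "A ** T = T ** transpose A"
    "T ** transpose C = B ** M" "C ** T = M ** transpose B"
  proof (rule state_space_isomorphism[of "M ** transpose B" "transpose A" "transpose C" C A "B ** M"])
    show "separates_states (transpose A) (M ** transpose B)"
      using ctr M(1) by (rule separates_states_mult_invertible)
    show "separates_states (transpose (transpose A)) (transpose (transpose C))"
      by (simp add: obs)
    show "(M ** transpose B) *v ((*v) (transpose A) ^^ k) (transpose C *v u)
        = C *v ((*v) A ^^ k) ((B ** M) *v u)" for k u
      by (rule markov(2)[symmetric])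
  qed (rule obs)
  \<comment> \<open>Transposing the three relations for \<open>T\<close> permutes them, so \<open>transpose T\<close> is an isomorphism
    between the same two realizations.\<close>
  have "transpose T = T"
  proof (rule state_space_isomorphism_unique[of "transpose A" "transpose C"])
    show "separates_states (transpose (transpose A)) (transpose (transpose C))"
      by (simp add: obs)
    show "A ** transpose T = transpose T ** transpose A"
      using arg_cong[OF T(2), of transpose] by (simp add: matrix_transpose_mul)
    show "A ** T = T ** transpose A" by (rule T)
    show "transpose T ** transpose C = T ** transpose C"
      using arg_cong[OF T(4), of transpose] by (simp add: matrix_transpose_mul M T(3))
  qed
  then show "\<exists>Q. invertible Q \<and> P ** Q = Q ** transpose P \<and> Q = transpose Q \<and> upper_right_block Q = 0"
    using T M markov(1)
    by (intro exI[of _ "system_matrix T 0 0 M"])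
      (simp add: assms(2) invertible_block_diagonal system_matrix_mult transpose_system_matrix
        system_matrix_eq_iff)
next
  assume "\<exists>Q. invertible Q \<and> P ** Q = Q ** transpose P \<and> Q = transpose Q \<and> upper_right_block Q = 0"
  then obtain Q where Q: "invertible Q" "P ** Q = Q ** transpose P" "Q = transpose Q"
    "upper_right_block Q = 0" by blast
  obtain T X Y M where Q_eq: "Q = system_matrix T X Y M" by (rule system_matrix_cases)
  have X: "X = 0" using Q(4) by (simp add: Q_eq)
  have sym: "transpose M = M" and Y: "Y = 0"
    using Q(3)[symmetric] by (simp_all add: Q_eq X transpose_system_matrix system_matrix_eq_iff)
  \<comment> \<open>The blocks of \<open>P Q = Q P\<^sup>T\<close> say that \<open>T\<close> intertwines the two realizations.\<close>
  have blocks: "A ** T = T ** transpose A" "T ** transpose C = B ** M"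
    "C ** T = M ** transpose B" "D ** M = M ** transpose D"
    using Q(2) by (simp_all add: Q_eq X Y assms(2) transpose_system_matrix system_matrix_mult
        system_matrix_eq_iff)
  have "invertible M"
    using Q(1) by (simp add: Q_eq X Y invertible_block_diagonal)
  moreover have "transfer_function A B C D ** const_matrix M
      = const_matrix M ** transpose (transfer_function A B C D)"
    using transfer_function_eq_if_intertwined[OF blocks(1-3), of "D ** M"]
    by (simp add: transpose_transfer_function transfer_function_mult_const
        const_mult_transfer_function blocks(4))
  ultimately show "symmetrizable (transfer_function A B C D)"
    unfolding symmetrizable_iff_symmetric_intertwiner using sym by blast
qed

end
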